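(* Let $k\in\mathbb N$ and, for $1\le i\le k$, let $q_i\in\mathbb Q_{>0}$, $a_i,b_i\in\mathbb N$ and $n_i,m_i\in\mathbb Z$. Assume that the set of polynomials $$\{x,\ y\}\cup\{q_i(a_ix+n_i)(b_iy+m_i)\mid 1\le i\le k\}$$ has cardinality $k+2\ge 5$ and that the pattern consisting of its elements is partition regular. Then $k=3$ and there is $q\in\mathbb Q_{>0}$ such that the pattern has the form (up to the order of its terms) $$x,\quad y,\quad qxy,\quad qxy+x,\quad qxy+y.$$ Moreover, for $q\in\mathbb Q_{>0}$, the partition regularity of the pattern $x,\ y,\ qxy,\ qxy+x,\ qxy+y$ is equivalent to the partition regularity of the pattern $x,\ y,\ xy,\ xy+x,\ xy+y$.
   Context: $\mathbb N$ denotes the set of positive integers ($0\notin\mathbb N$). A pattern $f_1(x,y),\dots,f_k(x,y)$ (with the $f_i$ rational-valued functions) is called partition regular if, for every finite colouring (partition into finitely many pieces) of $\mathbb N$, the set of monochromatic $k$-tuples $(f_1(u,v),\dots,f_k(u,v))$ with $u,v\in\mathbb N$ is infinite; here a tuple is monochromatic if all its entries belong to $\mathbb N$ and lie in the same colour. *)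

theory Defs
  imports "HOL-Computational_Algebra.Polynomial" "HOL-Library.Disjoint_Sets"
begin

text \<open>
  Here 0 is not a natural number: colourings are partitions of \<open>{0<..}\<close>, and both variables
  range over \<open>{0<..}\<close>. Pattern entries are rational-valued, so that membership in a colour class
  includes the requirement of being a positive integer. Tuples are lists.
\<close>

definition finite_colouring :: "nat set set \<Rightarrow> bool" where
  "finite_colouring \<C> \<longleftrightarrow> finite \<C> \<and> partition_on {0<..} \<C>"

definition monochromatic :: "nat set set \<Rightarrow> rat list \<Rightarrow> bool" where
  "monochromatic \<C> t \<longleftrightarrow> (\<exists>A\<in>\<C>. set t \<subseteq> of_nat ` A)"

definition partition_regular :: "(nat \<Rightarrow> nat \<Rightarrow> rat) list \<Rightarrow> bool" where
  "partition_regular fs \<longleftrightarrow>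
     (\<forall>\<C>. finite_colouring \<C> \<longrightarrow>
        infinite {t. \<exists>u>0. \<exists>v>0. t = map (\<lambda>f. f u v) fs \<and> monochromatic \<C> t})"

text \<open>
  The ring of polynomials in \<open>x\<close> and \<open>y\<close> over the rationals is represented as \<^typ>\<open>rat poly poly\<close>,
  where the inner variable is \<open>x\<close> and the outer one is \<open>y\<close>.
\<close>

type_synonym bipoly = "rat poly poly"

definition Const :: "rat \<Rightarrow> bipoly" where
  "Const c = [:[:c:]:]"

definition X :: bipoly where
  "X = [:[:0, 1:]:]"

definition Y :: bipoly where
  "Y = [:0, 1:]"

definition eval :: "bipoly \<Rightarrow> nat \<Rightarrow> nat \<Rightarrow> rat" where
  "eval p u v = poly (poly p [:of_nat v:]) (of_nat u)"

lemma eval_simps [simp]: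
  "eval (Const c) u v = c"
  "eval X u v = of_nat u"
  "eval Y u v = of_nat v"
  "eval (p + p') u v = eval p u v + eval p' u v"
  "eval (p * p') u v = eval p u v * eval p' u v"
  by (simp_all add: eval_def Const_def X_def Y_def)

definition polynomial_pattern_regular :: "bipoly list \<Rightarrow> bool" where
  "polynomial_pattern_regular ps \<longleftrightarrow> partition_regular (map eval ps)"

definition bilinear_term :: "rat \<Rightarrow> nat \<Rightarrow> int \<Rightarrow> nat \<Rightarrow> int \<Rightarrow> bipoly" where
  "bilinear_term q a n b m =
     Const q * (of_nat a * X + of_int n) * (of_nat b * Y + of_int m)"

end

theory Submission
  imports Defs "HOL-Computational_Algebra.Primes"
begin

text \<open>
  Write the \<open>i\<close>-th bilinear term as \<open>A\<^sub>i x y + B\<^sub>i x + C\<^sub>i y + B\<^sub>i C\<^sub>i / A\<^sub>i\<close>. The quotient of two such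
  terms tends to \<open>A\<^sub>i / A\<^sub>j\<close>, so a colouring by the size of \<open>ln n\<close> forces all \<open>A\<^sub>i\<close> to be one \<open>A\<close>.
  Modulo a large prime \<open>p\<close> all entries agree with one rational number \<open>t\<close> that depends only on the
  coefficients, and with \<open>s = A t\<close>, \<open>\<beta>\<^sub>i = s + B\<^sub>i\<close>, \<open>\<gamma>\<^sub>i = s + C\<^sub>i\<close> one gets \<open>\<beta>\<^sub>i \<gamma>\<^sub>i = s\<close>. Shifting
  all entries by \<open>t\<close> turns the \<open>i\<close>-th term into \<open>\<zeta> = \<beta>\<^sub>i \<xi> + \<gamma>\<^sub>i \<eta> + A \<xi> \<eta>\<close>, and one colours by the
  leading \<open>p\<close>-adic digit of \<open>\<xi>\<close>. If \<open>s = 0\<close>, the leading digits give the asserted form. If \<open>s \<noteq> 0\<close>,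
  they give \<open>\<beta>\<^sub>i = 1\<close>, \<open>\<gamma>\<^sub>i = 1\<close>, \<open>\<beta>\<^sub>i + \<gamma>\<^sub>i = 0\<close> or \<open>\<beta>\<^sub>i + \<gamma>\<^sub>i = 1\<close>, where the valuations of \<open>\<xi>\<close>
  and \<open>\<eta>\<close> decide between the first, the second and the last two cases. The last case is impossible:
  there \<open>\<zeta> = \<eta> + \<beta>\<^sub>i (\<xi> - \<eta>) + A \<xi> \<eta>\<close> with \<open>\<xi>, \<eta>, \<zeta>\<close> of the same valuation \<open>v\<close>, and \<open>A \<xi> \<eta>\<close> is
  visible at the \<open>p\<close>-adic position \<open>2 v\<close>. In each other case \<open>B\<^sub>i + C\<^sub>i\<close> and \<open>B\<^sub>i C\<^sub>i\<close> do not depend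
  on \<open>i\<close>, which leaves at most two terms.
\<close>

subsection \<open>Leading digits of bilinear expressions\<close>

text \<open>Both cofactors are prime to \<open>p\<close>, so the powers of \<open>p\<close> on the
  two sides agree and cancel. Reducing modulo \<open>p\<close> with \<open>e\<close> congruent to
  \<open>g\<close> leaves \<open>(c - \<beta>) * g\<close>, where \<open>g\<close> is
  invertible.\<close>

lemma leading_term_comparison:
  fixes p c \<beta> e g h :: int
  assumes "prime p" and "\<not> p dvd c" "\<not> p dvd \<beta>" "\<not> p dvd e" "\<not> p dvd g"
    and "p dvd e - g" and eq: "c * (p ^ k * g) = p ^ i * (\<beta> * e + p * h)"
  shows "k = i" and "p dvd c - \<beta>"
proof -
  have cg: "\<not> p dvd c * g" and w: "\<not> p dvd \<beta> * e + p * h"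
    using assms by (auto simp: prime_dvd_mult_iff dvd_add_left_iff)
  have p0: "p \<noteq> 0" using assms(1) by auto
  have eq': "p ^ k * (c * g) = p ^ i * (\<beta> * e + p * h)"
    using eq by (simp add: algebra_simps)
  have *: "multiplicity p (p ^ n * x) = n" if "\<not> p dvd x" for n x
    using that assms(1) p0
    by (subst prime_elem_multiplicity_mult_distrib)
       (auto simp: not_dvd_imp_multiplicity_0 multiplicity_same_power)
  show ki: "k = i" using *[OF cg, of k] *[OF w, of i] eq' by simp
  have "c * g = \<beta> * e + p * h" using eq' ki p0 by simp
  then have "(c - \<beta>) * g = \<beta> * (e - g) + p * h" by (simp add: algebra_simps)
  then have "p dvd (c - \<beta>) * g" using assms(6) by (metis dvd_add dvd_mult dvd_triv_left)
  then show "p dvd c - \<beta>" using assms by (simp add: prime_dvd_mult_iff)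
qed

text \<open>By \<open>eq\<close>, the combination \<open>c * (G - F) - \<beta> * (E - F)\<close>
  equals \<open>\<alpha> * E * F\<close>, of valuation exactly \<open>2 * v\<close>. Equal scaled
  residues put the residues modulo \<open>m\<close> within \<open>m / N\<close> of each other, so
  the same combination of residues is too small to be a nonzero multiple of
  \<open>p ^ (2 * v)\<close>.\<close>

lemma scaled_residue_contradiction:
  fixes p c \<beta> \<alpha> E F G e f :: int
  assumes "prime p" and c: "c > 0"
    and E: "E = p ^ v * e" and F: "F = p ^ v * f"
    and nd: "\<not> p dvd \<alpha>" "\<not> p dvd e" "\<not> p dvd f"
    and eq: "c * G = c * F + \<beta> * (E - F) + \<alpha> * E * F"
    and N: "N \<ge> (c + \<bar>\<beta>\<bar>) * p"
    and m: "m = p ^ (2 * v + 1)"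
    and col: "(N * (E mod m)) div m = (N * (F mod m)) div m"
             "(N * (G mod m)) div m = (N * (F mod m)) div m"
  shows False
proof -
  have p1: "p > 1" using assms(1) prime_gt_1_int by blast
  have m0: "m > 0" using m p1 by simp
  \<comment> \<open>\<open>N * a\<close> and \<open>N * b\<close> lie in one block of length
    \<open>m\<close>.\<close>
  have close: "\<bar>N * (a - b)\<bar> < m" if "(N * a) div m = (N * b) div m" for a b
  proof -
    have "N * a - N * b = (N * a) mod m - (N * b) mod m"
      using that by (metis minus_mult_div_eq_mod diff_diff_eq2 diff_add_cancel add_diff_cancel_left)
    moreover have "0 \<le> (N * a) mod m" "(N * a) mod m < m" "0 \<le> (N * b) mod m" "(N * b) mod m < m"
      using m0 by auto
    ultimately show ?thesis unfolding right_diff_distrib by linarith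
  qed
  \<comment> \<open>This is \<open>c * (G - F) - \<beta> * (E - F)\<close> formed with residues:
    congruent to it modulo \<open>m\<close>, yet small.\<close>
  define \<delta> where "\<delta> = c * (G mod m - F mod m) - \<beta> * (E mod m - F mod m)"
  have cb: "c + \<bar>\<beta>\<bar> > 0" using c by simp
  have Npos: "N > 0" using N cb p1 by (smt (verit) mult_pos_pos)
  have "N * \<bar>\<delta>\<bar> \<le> c * \<bar>N * (G mod m - F mod m)\<bar> + \<bar>\<beta>\<bar> * \<bar>N * (E mod m - F mod m)\<bar>"
  proof -
    have "N * \<bar>\<delta>\<bar> = \<bar>c * (N * (G mod m - F mod m)) - \<beta> * (N * (E mod m - F mod m))\<bar>"
      using Npos unfolding \<delta>_def by (simp add: abs_mult_pos' algebra_simps)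
    also have "\<dots> \<le> \<bar>c * (N * (G mod m - F mod m))\<bar> + \<bar>\<beta> * (N * (E mod m - F mod m))\<bar>"
      by linarith
    finally show ?thesis using c by (simp add: abs_mult)
  qed
  also have "\<dots> < c * m + \<bar>\<beta>\<bar> * m"
    using close[OF col(1)] close[OF col(2)] c
    by (intro add_less_le_mono mult_strict_left_mono mult_left_mono) auto
  finally have lt: "N * \<bar>\<delta>\<bar> < (c + \<bar>\<beta>\<bar>) * m" by (simp add: algebra_simps)
  have "(c + \<bar>\<beta>\<bar>) * (p * \<bar>\<delta>\<bar>) \<le> N * \<bar>\<delta>\<bar>"
    using mult_right_mono[OF N, of "\<bar>\<delta>\<bar>"] by (simp add: algebra_simps)
  then have "(c + \<bar>\<beta>\<bar>) * (p * \<bar>\<delta>\<bar>) < (c + \<bar>\<beta>\<bar>) * m" using lt by linarith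
  \<comment> \<open>The factor \<open>p\<close> in the bound on \<open>N\<close> pays for the extra
    exponent in \<open>m = p ^ (2 * v + 1)\<close>.\<close>
  then have "p * \<bar>\<delta>\<bar> < m" using cb by simp
  then have small: "\<bar>\<delta>\<bar> < p ^ (2 * v)" using p1 by (simp add: m)
  have "m dvd (c * (G - F) - \<beta> * (E - F)) - \<delta>"
  proof -
    have "c * ((G - G mod m) - (F - F mod m)) - \<beta> * ((E - E mod m) - (F - F mod m)) =
        m * (c * (G div m - F div m) - \<beta> * (E div m - F div m))"
      by (simp add: minus_mod_eq_mult_div right_diff_distrib mult.left_commute)
    then have "m dvd c * ((G - G mod m) - (F - F mod m)) - \<beta> * ((E - E mod m) - (F - F mod m))"
      by simp
    then show ?thesis unfolding \<delta>_def by (simp add: algebra_simps)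
  qed
  moreover have "c * (G - F) - \<beta> * (E - F) = p ^ (2 * v) * (\<alpha> * e * f)"
  proof -
    have "p ^ (2 * v) = p ^ v * p ^ v" by (simp add: power_add mult_2)
    moreover have "c * (G - F) - \<beta> * (E - F) = \<alpha> * E * F"
      using eq by (simp add: algebra_simps)
    ultimately show ?thesis by (simp add: E F)
  qed
  ultimately have md: "m dvd p ^ (2 * v) * (\<alpha> * e * f) - \<delta>" by simp
  then have "p ^ (2 * v) dvd p ^ (2 * v) * (\<alpha> * e * f) - \<delta>"
    unfolding m by (metis dvd_mult_left power_add)
  then have "p ^ (2 * v) dvd \<delta>"
    by (metis dvd_diff_right_iff dvd_triv_left)
  then have "\<delta> = 0" using small dvd_imp_le_int[of \<delta> "p ^ (2 * v)"] p1 by force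
  then have "p ^ (2 * v) * p dvd p ^ (2 * v) * (\<alpha> * e * f)" using md by (simp add: m mult.commute)
  then have "p dvd \<alpha> * e * f" using p1 by simp
  then show False using assms(1) nd by (simp add: prime_dvd_mult_iff)
qed

definition leading_digit :: "int \<Rightarrow> int \<Rightarrow> int" where
  "leading_digit p E = (E div p ^ multiplicity p E) mod p"

text \<open>
  This records, up to an error of \<open>1/N\<close>, the position of \<open>E\<close> modulo \<open>p\<^bsup>2v+1\<^esup>\<close>
  inside the period, where \<open>v\<close> is the valuation of \<open>E\<close>. Unlike a single digit, it behaves almost
  additively.
\<close>

definition scaled_residue :: "int \<Rightarrow> int \<Rightarrow> int \<Rightarrow> int" where
  "scaled_residue p N E =
     (N * (E mod p ^ (2 * multiplicity p E + 1))) div p ^ (2 * multiplicity p E + 1)"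

lemma leading_digit_eq:
  assumes "E = p ^ multiplicity p E * e" "p \<noteq> 0"
  shows "leading_digit p E = e mod p"
proof -
  have "E div p ^ multiplicity p E = e"
    using assms by (metis nonzero_mult_div_cancel_left power_not_zero)
  then show ?thesis by (simp add: leading_digit_def)
qed

text \<open>Since \<open>p\<close> divides \<open>E\<close> and \<open>F\<close>, the product term
  has higher valuation than either of them, so the linear term of least valuation fixes the leading
  digit of \<open>c * G\<close>. The assumption \<open>large\<close> turns the resulting congruences
  of coefficients into equalities.\<close>

lemma bilinear_leading_digits:
  fixes p c \<beta> \<gamma> \<alpha> E F G :: int
  assumes p: "prime p" and c: "c > 0" "\<not> p dvd c" and \<alpha>: "\<not> p dvd \<alpha>"
    and large: "\<And>n. n \<in> {\<beta>, \<gamma>, c - \<beta>, c - \<gamma>, \<beta> + \<gamma>, c - (\<beta> + \<gamma>)} \<Longrightarrow> p dvd n \<Longrightarrow> n = 0"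
    and nz: "E \<noteq> 0" "F \<noteq> 0" "G \<noteq> 0" and dvd: "p dvd E" "p dvd F"
    and eq: "c * G = \<beta> * E + \<gamma> * F + \<alpha> * E * F"
    and ld: "leading_digit p E = leading_digit p F" "leading_digit p G = leading_digit p F"
    and sr: "scaled_residue p N E = scaled_residue p N F"
      "scaled_residue p N G = scaled_residue p N F"
    and N: "N \<ge> (c + \<bar>\<beta>\<bar>) * p"
  shows "\<gamma> = 0 \<Longrightarrow> \<beta> \<noteq> 0 \<Longrightarrow> \<beta> = c"
    and "\<beta> = 0 \<Longrightarrow> \<gamma> \<noteq> 0 \<Longrightarrow> \<gamma> = c"
    and "\<beta> \<noteq> 0 \<Longrightarrow> \<gamma> \<noteq> 0 \<Longrightarrow> multiplicity p E < multiplicity p F \<Longrightarrow> \<beta> = c"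
    and "\<beta> \<noteq> 0 \<Longrightarrow> \<gamma> \<noteq> 0 \<Longrightarrow> multiplicity p F < multiplicity p E \<Longrightarrow> \<gamma> = c"
    and "\<beta> \<noteq> 0 \<Longrightarrow> \<gamma> \<noteq> 0 \<Longrightarrow> multiplicity p E = multiplicity p F \<Longrightarrow> \<beta> + \<gamma> = 0"
proof -
  have p0: "p \<noteq> 0" "\<not> is_unit p" using p by auto
  define i j k where "i = multiplicity p E" and "j = multiplicity p F" and "k = multiplicity p G"
  obtain e where e: "E = p ^ i * e" "\<not> p dvd e"
    using multiplicity_decompose'[OF nz(1) p0(2)] unfolding i_def by blast
  obtain f where f: "F = p ^ j * f" "\<not> p dvd f"
    using multiplicity_decompose'[OF nz(2) p0(2)] unfolding j_def by blast
  obtain g where g: "G = p ^ k * g" "\<not> p dvd g"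
    using multiplicity_decompose'[OF nz(3) p0(2)] unfolding k_def by blast
  have "e mod p = f mod p" "g mod p = f mod p"
    using ld leading_digit_eq[OF e(1)[unfolded i_def] p0(1)]
      leading_digit_eq[OF f(1)[unfolded j_def] p0(1)]
      leading_digit_eq[OF g(1)[unfolded k_def] p0(1)] by metis+
  then have efg: "p dvd e - g" "p dvd f - g" "p dvd f - e"
    by (metis mod_eq_dvd_iff)+
  obtain E' where E': "E = p * E'" using dvd by blast
  obtain F' where F': "F = p * F'" using dvd by blast
  \<comment> \<open>The product is written in two ways, with \<open>p\<close> taken out of
    \<open>F\<close> or of \<open>E\<close>, so that it can join the error term relative to
    either.\<close>
  have eqF: "c * (p ^ k * g) = \<beta> * E + \<gamma> * F + \<alpha> * E * (p * F')"
    using eq unfolding g(1)[symmetric] F'[symmetric] .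
  have eqE: "c * (p ^ k * g) = \<beta> * E + \<gamma> * F + \<alpha> * F * (p * E')"
    using eq unfolding g(1)[symmetric] E'[symmetric] by (simp add: mult.assoc mult.commute)
  \<comment> \<open>Here \<open>x\<close> is the coefficient of the dominant linear term. The
    equality of exponents is kept because scaled residues can only be compared at one
    modulus.\<close>
  have concl: "x = c \<and> k = n"
    if "x \<in> {\<beta>, \<gamma>, \<beta> + \<gamma>}" "x \<noteq> 0" "\<not> p dvd y" "p dvd y - g"
      "c * (p ^ k * g) = p ^ n * (x * y + p * h)" for x n y h
  proof -
    have "\<not> p dvd x" using large[of x] that by auto
    from leading_term_comparison[OF p c(2) this that(3) g(2) that(4,5)] show ?thesis
      using large[of "c - x"] that(1) by auto
  qed
  show "\<beta> = c" if "\<gamma> = 0" "\<beta> \<noteq> 0"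
  proof -
    have "c * (p ^ k * g) = \<beta> * E + \<alpha> * E * (p * F')"
      using eqF that by simp
    also have "\<dots> = p ^ i * (\<beta> * e + p * (\<alpha> * e * F'))"
      unfolding e(1) by (simp add: algebra_simps)
    finally show ?thesis using concl[of \<beta> e] that e efg by auto
  qed
  show "\<gamma> = c" if "\<beta> = 0" "\<gamma> \<noteq> 0"
  proof -
    have "c * (p ^ k * g) = \<gamma> * F + \<alpha> * F * (p * E')"
      using eqE that by simp
    also have "\<dots> = p ^ j * (\<gamma> * f + p * (\<alpha> * f * E'))"
      unfolding f(1) by (simp add: algebra_simps)
    finally show ?thesis using concl[of \<gamma> f] that f efg by auto
  qed
  show "\<beta> = c" if "\<beta> \<noteq> 0" "\<gamma> \<noteq> 0" "multiplicity p E < multiplicity p F"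
  proof -
    obtain d where "j = i + Suc d"
      using \<open>multiplicity p E < multiplicity p F\<close> less_imp_add_positive gr0_implies_Suc unfolding i_def j_def by metis
    then have F1: "F = p ^ i * (p * (p ^ d * f))" by (simp add: f power_add)
    have "c * (p ^ k * g) = \<beta> * E + \<gamma> * F + \<alpha> * E * (p * F')"
      by (rule eqF)
    also have "\<dots> = p ^ i * (\<beta> * e + p * (\<gamma> * (p ^ d * f) + \<alpha> * e * F'))"
      unfolding F1 e(1) by (simp add: algebra_simps)
    finally show ?thesis using concl[of \<beta> e] that e efg by auto
  qed
  show "\<gamma> = c" if "\<beta> \<noteq> 0" "\<gamma> \<noteq> 0" "multiplicity p F < multiplicity p E"
  proof -
    obtain d where "i = j + Suc d"
      using \<open>multiplicity p F < multiplicity p E\<close> less_imp_add_positive gr0_implies_Suc unfolding i_def j_def by metis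
    then have E1: "E = p ^ j * (p * (p ^ d * e))" by (simp add: e power_add)
    have "c * (p ^ k * g) = \<beta> * E + \<gamma> * F + \<alpha> * F * (p * E')"
      by (rule eqE)
    also have "\<dots> = p ^ j * (\<gamma> * f + p * (\<beta> * (p ^ d * e) + \<alpha> * f * E'))"
      unfolding E1 f(1) by (simp add: algebra_simps)
    finally show ?thesis using concl[of \<gamma> f] that f efg by auto
  qed
  show "\<beta> + \<gamma> = 0" if "\<beta> \<noteq> 0" "\<gamma> \<noteq> 0" "multiplicity p E = multiplicity p F"
  proof (rule ccontr)
    assume nz': "\<beta> + \<gamma> \<noteq> 0"
    have ij: "j = i" using that by (simp add: i_def j_def)
    obtain h where "f - e = p * h" using efg(3) by blast
    then have h: "f = e + p * h" by simp
    have "c * (p ^ k * g) = \<beta> * E + \<gamma> * F + \<alpha> * E * (p * F')"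
      by (rule eqF)
    also have "\<dots> = p ^ i * ((\<beta> + \<gamma>) * e + p * (\<gamma> * h + \<alpha> * e * F'))"
      unfolding e(1) f(1) ij by (simp add: h algebra_simps)
    finally have "\<beta> + \<gamma> = c" "k = i" using concl[of "\<beta> + \<gamma>" e] nz' e efg by auto
    \<comment> \<open>Leading digits alone cannot exclude \<open>\<beta> + \<gamma> = c\<close>. Now
      \<open>E\<close>, \<open>F\<close> and \<open>G\<close> have one valuation, so their scaled
      residues share the modulus \<open>p ^ (2 * i + 1)\<close>, where the product term is
      visible.\<close>
    then have \<gamma>: "\<gamma> = c - \<beta>" by simp
    have "c * G = c * F + \<beta> * (E - F) + \<alpha> * E * F"
      using eq by (simp add: \<gamma> algebra_simps)
    moreover have "F = p ^ i * f" using f(1) ij by simp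
    moreover have "(N * (E mod p ^ (2 * i + 1))) div p ^ (2 * i + 1) =
        (N * (F mod p ^ (2 * i + 1))) div p ^ (2 * i + 1)"
      using sr(1) ij unfolding scaled_residue_def i_def j_def by metis
    moreover have "(N * (G mod p ^ (2 * i + 1))) div p ^ (2 * i + 1) =
        (N * (F mod p ^ (2 * i + 1))) div p ^ (2 * i + 1)"
      using sr(2) ij \<open>k = i\<close> unfolding scaled_residue_def i_def j_def k_def by metis
    ultimately show False
      using scaled_residue_contradiction[OF p c(1) e(1) _ \<alpha> e(2) f(2) _ N refl] by blast
  qed
qed

subsection \<open>Bilinear families\<close>

text \<open>A definition cannot quantify over colour types. Integer triples suffice: the richest
  colouring used records a residue, a leading digit and a scaled residue, and simpler ones are
  padded with zeros. The bound \<open>N\<close> supplies solutions with all entries large.\<close>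

definition bilinear_regular ::
  "'i set \<Rightarrow> ('i \<Rightarrow> rat) \<Rightarrow> ('i \<Rightarrow> rat) \<Rightarrow> ('i \<Rightarrow> rat) \<Rightarrow> bool" where
  "bilinear_regular I A B C \<longleftrightarrow>
     (\<forall>(f :: nat \<Rightarrow> int \<times> int \<times> int) N. finite (range f) \<longrightarrow>
        (\<exists>x>N. \<exists>y>N. f y = f x \<and>
          (\<exists>z. \<forall>i\<in>I. z i > N \<and> f (z i) = f x \<and>
             of_nat (z i) = A i * of_nat x * of_nat y + B i * of_nat x + C i * of_nat y
               + B i * C i / A i)))"

section \<open>Equality of the leading coefficients by a logarithmic colouring\<close>

lemma eventually_ln_shift_small:
  fixes r \<epsilon> :: real
  assumes "\<epsilon> > 0"
  shows "\<forall>\<^sub>F n in sequentially. 1 + r / real n > 0 \<and> \<bar>ln (1 + r / real n)\<bar> < \<epsilon>"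
proof -
  have "(\<lambda>n. 1 + r / real n) \<longlonglongrightarrow> 1 + 0"
    by (intro tendsto_intros lim_const_over_n)
  then have 1: "(\<lambda>n. 1 + r / real n) \<longlonglongrightarrow> 1" by simp
  have "(\<lambda>n. ln (1 + r / real n)) \<longlonglongrightarrow> ln 1"
    by (rule tendsto_ln[OF 1]) simp
  then have "\<forall>\<^sub>F n in sequentially. \<bar>ln (1 + r / real n)\<bar> < \<epsilon>"
    using assms by (simp add: tendsto_iff dist_real_def)
  moreover have "\<forall>\<^sub>F n in sequentially. 1 + r / real n > 0"
    by (rule order_tendstoD(1)[OF 1]) simp
  ultimately show ?thesis by (simp add: eventually_conj_iff)
qed

lemma floor_mod_4_neq:
  fixes a b :: real
  assumes "b + 1 < a" "a < b + 3"
  shows "\<lfloor>a\<rfloor> mod 4 \<noteq> \<lfloor>b\<rfloor> mod 4"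
proof -
  have "1 \<le> \<lfloor>a\<rfloor> - \<lfloor>b\<rfloor>" "\<lfloor>a\<rfloor> - \<lfloor>b\<rfloor> \<le> 3" using assms by linarith+
  then show ?thesis by presburger
qed

text \<open>If \<open>A i > A j\<close>, then for large \<open>x\<close> and \<open>y\<close> the
  difference \<open>ln (z i) - ln (z j)\<close> is close to the positive constant
  \<open>\<theta>\<close>, which a colouring by logarithms at the scale of \<open>\<theta>\<close>
  detects. Exchanging \<open>i\<close> and \<open>j\<close> yields equality.\<close>

lemma bilinear_regular_leading_le:
  assumes reg: "bilinear_regular I A B C" and ij: "i \<in> I" "j \<in> I" and pos: "A i > 0" "A j > 0"
  shows "A i \<le> A j"
proof (rule ccontr)
  assume "\<not> A i \<le> A j"
  define \<theta> :: real where "\<theta> = ln (of_rat (A i)) - ln (of_rat (A j))"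
  have \<theta>: "\<theta> > 0" using \<open>\<not> A i \<le> A j\<close> pos by (simp add: \<theta>_def of_rat_less)
  \<comment> \<open>Each term factors as \<open>A (x + C / A) (y + B / A)\<close>; these are the
    shifts relative to \<open>x\<close> and \<open>y\<close>. Four logarithmic errors below
    \<open>\<theta> / 8\<close> add up to less than \<open>\<theta> / 2\<close>.\<close>
  define S where "S = {B i / A i, C i / A i, B j / A j, C j / A j}"
  have "\<forall>\<^sub>F n in sequentially. \<forall>r\<in>S.
      1 + of_rat r / real n > 0 \<and> \<bar>ln (1 + of_rat r / real n)\<bar> < \<theta> / 8"
    by (intro eventually_ball_finite ballI eventually_ln_shift_small) (simp_all add: S_def \<theta>)
  then obtain N where N: "\<And>n r. n \<ge> N \<Longrightarrow> r \<in> S \<Longrightarrow>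
      1 + of_rat r / real n > 0 \<and> \<bar>ln (1 + of_rat r / real n)\<bar> < \<theta> / 8"
    unfolding eventually_sequentially by blast
  \<comment> \<open>At scale \<open>2 / \<theta>\<close> a difference between
    \<open>\<theta> / 2\<close> and \<open>3 * \<theta> / 2\<close> lies between 1 and 3, so the
    floors differ modulo 4.\<close>
  define f :: "nat \<Rightarrow> int \<times> int \<times> int" where "f n = (\<lfloor>2 * ln (real n) / \<theta>\<rfloor> mod 4, 0, 0)" for n
  have "range f \<subseteq> {0..<4} \<times> {0} \<times> {0}" by (auto simp: f_def)
  then have "finite (range f)" by (rule finite_subset) simp
  then obtain x y z where xy: "x > N" "y > N"
    and z: "\<And>i. i \<in> I \<Longrightarrow> f (z i) = f x \<and> of_nat (z i) =
      A i * of_nat x * of_nat y + B i * of_nat x + C i * of_nat y + B i * C i / A i"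
    using reg unfolding bilinear_regular_def by metis
  have *: "\<bar>ln (real (z k)) - (ln (of_rat (A k)) + ln (real x) + ln (real y))\<bar> < \<theta> / 4"
    if k: "k \<in> I" "A k > 0" "B k / A k \<in> S" "C k / A k \<in> S" for k
  proof -
    define u v where "u = 1 + of_rat (C k / A k) / real x" and "v = 1 + of_rat (B k / A k) / real y"
    have uv: "u > 0" "\<bar>ln u\<bar> < \<theta> / 8" "v > 0" "\<bar>ln v\<bar> < \<theta> / 8"
      using N[of x] N[of y] xy k by (simp_all add: u_def v_def)
    have "of_nat (z k) =
        A k * of_nat x * of_nat y * ((1 + C k / A k / of_nat x) * (1 + B k / A k / of_nat y))"
    proof -
      have "of_nat (z k) = A k * (of_nat x + C k / A k) * (of_nat y + B k / A k)"
        using k(2) z[OF k(1)] by (simp add: field_simps)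
      also have "of_nat x + C k / A k = of_nat x * (1 + C k / A k / of_nat x)"
        using xy by (simp add: distrib_left)
      also have "of_nat y + B k / A k = of_nat y * (1 + B k / A k / of_nat y)"
        using xy by (simp add: distrib_left)
      finally show ?thesis by (simp only: mult_ac)
    qed
    from arg_cong[OF this, of "of_rat :: rat \<Rightarrow> real"]
    have "real (z k) = of_rat (A k) * real x * real y * (u * v)"
      by (simp add: u_def v_def of_rat_add of_rat_mult of_rat_divide)
    then have "ln (real (z k)) = ln (of_rat (A k)) + ln (real x) + ln (real y) + (ln u + ln v)"
      using uv xy k(2) by (simp add: ln_mult)
    then show ?thesis using uv by linarith
  qed
  have "\<bar>ln (real (z i)) - (ln (of_rat (A i)) + ln (real x) + ln (real y))\<bar> < \<theta> / 4"
    "\<bar>ln (real (z j)) - (ln (of_rat (A j)) + ln (real x) + ln (real y))\<bar> < \<theta> / 4"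
    using *[of i] *[of j] ij pos by (simp_all add: S_def)
  then have "\<bar>ln (real (z i)) - ln (real (z j)) - \<theta>\<bar> < \<theta> / 2"
    using \<theta>_def by linarith
  then have "\<theta> / 2 < ln (real (z i)) - ln (real (z j))"
    "ln (real (z i)) - ln (real (z j)) < 3 * \<theta> / 2" by linarith+
  then have "(2 * ln (real (z j)) + \<theta>) / \<theta> < 2 * ln (real (z i)) / \<theta>"
    "2 * ln (real (z i)) / \<theta> < (2 * ln (real (z j)) + 3 * \<theta>) / \<theta>"
    using \<theta> by (auto intro!: divide_strict_right_mono)
  then have "2 * ln (real (z j)) / \<theta> + 1 < 2 * ln (real (z i)) / \<theta>"
    "2 * ln (real (z i)) / \<theta> < 2 * ln (real (z j)) / \<theta> + 3"
    using \<theta> by (simp_all add: add_divide_distrib)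
  from floor_mod_4_neq[OF this] show False
    using z[of i] z[of j] ij by (simp add: f_def)
qed

section \<open>Auxiliary facts: denominators, large primes, pairs with given sum and product\<close>

lemma common_denominator:
  fixes S :: "rat set"
  assumes "finite S"
  obtains c :: int where "c > 0" "\<And>q. q \<in> S \<Longrightarrow> of_int c * q \<in> \<int>"
proof -
  have "\<exists>c::int. c > 0 \<and> (\<forall>q\<in>S. of_int c * q \<in> \<int>)"
    using assms
  proof (induction S)
    case empty
    show ?case by (intro exI[of _ 1]) simp
  next
    case (insert q S)
    then obtain c :: int where c: "c > 0" "\<And>q. q \<in> S \<Longrightarrow> of_int c * q \<in> \<int>" by blast
    obtain m d where q: "q = Fract m d" "d > 0" by (cases q) auto
    have "of_int (c * d) * r \<in> \<int>" if "r \<in> S" for r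
      using Ints_mult[OF Ints_of_int[of d] c(2)[OF that]] by (simp add: mult_ac)
    moreover have "of_int (c * d) * q = of_int (c * m)"
      using q by (simp add: Fract_of_int_quotient)
    then have "of_int (c * d) * q \<in> \<int>" by (metis Ints_of_int)
    ultimately show ?case using c q by (intro exI[of _ "c * d"]) auto
  qed
  then show ?thesis using that by blast
qed

text \<open>A prime exceeding the sum of the absolute values divides no nonzero element. This is how
  congruences between fixed coefficients become equalities.\<close>

lemma large_prime:
  fixes S :: "int set"
  assumes "finite S"
  obtains p :: int where "prime p" "\<And>n. n \<in> S \<Longrightarrow> p dvd n \<Longrightarrow> n = 0"
proof -
  obtain q :: nat where q: "prime q" "q > (\<Sum>n\<in>S. nat \<bar>n\<bar>)" using bigger_prime by blast
  have "n = 0" if "n \<in> S" "int q dvd n" for n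
  proof (rule ccontr)
    assume "n \<noteq> 0"
    have "nat \<bar>n\<bar> \<le> (\<Sum>n\<in>S. nat \<bar>n\<bar>)"
      using member_le_sum[of n S "\<lambda>n. nat \<bar>n\<bar>"] that assms by simp
    then have "\<bar>n\<bar> < int q" using q by linarith
    then show False using dvd_imp_le_int[OF \<open>n \<noteq> 0\<close> that(2)] by simp
  qed
  then show ?thesis using q that[of "int q"] by simp
qed

text \<open>All pairs consist of the two roots of one monic quadratic, so they agree up to
  order.\<close>

lemma card_same_sum_and_product:
  fixes B C :: "'i \<Rightarrow> 'a :: idom"
  assumes "\<And>n m. n \<in> I \<Longrightarrow> m \<in> I \<Longrightarrow> B n + C n = B m + C m \<and> B n * C n = B m * C m"
  shows "card ((\<lambda>n. (B n, C n)) ` I) \<le> 2"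
proof (cases "I = {}")
  case False
  then obtain m where m: "m \<in> I" by blast
  have *: "(B n, C n) \<in> {(B m, C m), (C m, B m)}" if n: "n \<in> I" for n
  proof -
    have sum: "B n + C n = B m + C m" and product: "B n * C n = B m * C m"
      using assms[OF n m] by auto
    have "(B n - B m) * (B n - C m) = B n * B n - B n * (B m + C m) + B m * C m"
      by (simp add: algebra_simps)
    also have "\<dots> = 0" unfolding sum[symmetric] product[symmetric] by (simp add: algebra_simps)
    finally consider "B n = B m" | "B n = C m" by auto
    then show ?thesis
    proof cases
      case 1
      then show ?thesis using sum by simp
    next
      case 2
      then have "C n = B m" using sum by (simp add: add.commute)
      then show ?thesis using 2 by simp
    qed
  qed
  have "card ((\<lambda>n. (B n, C n)) ` I) \<le> card {(B m, C m), (C m, B m)}"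
    by (intro card_mono image_subsetI *) simp
  also have "card {u, v} \<le> 2" for u v :: "'a \<times> 'a" by (simp add: card_insert_if)
  finally show ?thesis .
qed simp

section \<open>The common residue of the entries modulo primes\<close>

lemma bilinear_regular_mod_prime:
  fixes p :: int
  assumes "bilinear_regular I A B C" "prime p"
  obtains x y :: nat and z where "p dvd int y - int x"
    "\<And>i. i \<in> I \<Longrightarrow> p dvd int (z i) - int x \<and>
      of_nat (z i) = A i * of_nat x * of_nat y + B i * of_nat x + C i * of_nat y + B i * C i / A i"
proof -
  define f :: "nat \<Rightarrow> int \<times> int \<times> int" where "f n = (int n mod p, 0, 0)" for n
  have "range f \<subseteq> {0..<p} \<times> {0} \<times> {0}"
    using prime_gt_0_int[OF assms(2)] by (auto simp: f_def)
  then have "finite (range f)" by (rule finite_subset) simp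
  then obtain x y z where "f y = f x" "\<forall>i\<in>I. f (z i) = f x \<and> of_nat (z i) =
      A i * of_nat x * of_nat y + B i * of_nat x + C i * of_nat y + B i * C i / A i"
    using assms(1) unfolding bilinear_regular_def by metis
  then show ?thesis using that[of y x z] by (simp add: f_def mod_eq_dvd_iff)
qed

text \<open>Modulo \<open>p\<close> every entry is \<open>x\<close>, so \<open>x\<close> is a root
  of one quadratic for each index. Two quadratics with different sums \<open>B + C\<close> differ by
  a linear congruence, whose solution \<open>T / b\<close> depends only on the coefficients; for a
  large prime it is an exact root of all the quadratics. The last conclusion covers every prime
  because later the prime is chosen in terms of \<open>b\<close> and \<open>T\<close>.\<close>

lemma bilinear_regular_residue:
  assumes reg: "bilinear_regular I (\<lambda>_. a) B C" and fin: "finite I"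
    and card: "card ((\<lambda>n. (B n, C n)) ` I) \<ge> 3" and a: "a > 0"
  obtains b T :: int where "b \<noteq> 0"
    "\<And>n. n \<in> I \<Longrightarrow> (a * (of_int T / of_int b) + B n) * (a * (of_int T / of_int b) + C n)
        = a * (of_int T / of_int b)"
    "\<And>(p :: int) (x :: nat) (y :: nat) z. prime p \<Longrightarrow> p dvd int y - int x \<Longrightarrow>
      (\<And>i. i \<in> I \<Longrightarrow> p dvd int (z i) - int x \<and>
        of_nat (z i) = a * of_nat x * of_nat y + B i * of_nat x + C i * of_nat y + B i * C i / a) \<Longrightarrow>
      p dvd b * int x - T"
proof -
  obtain c :: int where c: "c > 0"
    and cd: "\<And>q. q \<in> insert a (\<Union>n\<in>I. {B n, C n, B n * C n / a}) \<Longrightarrow> of_int c * q \<in> \<int>"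
    using common_denominator[of "insert a (\<Union>n\<in>I. {B n, C n, B n * C n / a})"] fin by auto
  define a' B' C' D' where "a' = \<lfloor>of_int c * a\<rfloor>" and "B' n = \<lfloor>of_int c * B n\<rfloor>"
    and "C' n = \<lfloor>of_int c * C n\<rfloor>" and "D' n = \<lfloor>of_int c * (B n * C n / a)\<rfloor>" for n
  have a': "of_int c * a = of_int a'"
    unfolding a'_def by (rule of_int_floor[symmetric], rule cd) simp
  have B'C'D': "of_int c * B n = of_int (B' n) \<and> of_int c * C n = of_int (C' n) \<and>
      of_int c * (B n * C n / a) = of_int (D' n)" if "n \<in> I" for n
    unfolding B'_def C'_def D'_def
    by (intro conjI of_int_floor[symmetric] cd) (use that in blast)+
  have sol: "c * int (z n) = a' * int x * int y + B' n * int x + C' n * int y + D' n"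
    if "n \<in> I" "of_nat (z n) = a * of_nat x * of_nat y + B n * of_nat x + C n * of_nat y + B n * C n / a"
    for n x y and z :: "'a \<Rightarrow> nat"
  proof -
    have "(of_int (c * int (z n)) :: rat) = of_int c * of_nat (z n)" by simp
    also have "\<dots> = (of_int c * a) * of_nat x * of_nat y + (of_int c * B n) * of_nat x
        + (of_int c * C n) * of_nat y + of_int c * (B n * C n / a)"
      unfolding that(2) by (simp add: distrib_left mult.assoc)
    also have "\<dots> = of_int (a' * int x * int y + B' n * int x + C' n * int y + D' n)"
      using a' B'C'D'[OF that(1)] by simp
    finally show ?thesis by (simp only: of_int_eq_iff)
  qed
  define S where "S n = B' n + C' n" for n
  have root: "p dvd a' * int x * int x + (S n - c) * int x + D' n"
    if dvd: "p dvd int y - int x" "p dvd int (z n) - int x" and n: "n \<in> I"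
      and eq: "of_nat (z n) = a * of_nat x * of_nat y + B n * of_nat x + C n * of_nat y + B n * C n / a"
    for p :: int and n x y and z :: "'a \<Rightarrow> nat"
  proof -
    obtain h k where "int y - int x = p * h" "int (z n) - int x = p * k"
      using dvd by (metis dvdE)
    then have h: "int y = int x + p * h" and k: "int (z n) = int x + p * k" by simp_all
    have "a' * int x * int x + (S n - c) * int x + D' n = p * (c * k - a' * int x * h - C' n * h)"
      using sol[of n z x y, OF n eq] unfolding h k S_def by (simp add: algebra_simps)
    then show ?thesis by simp
  qed
  show ?thesis
  proof (cases "\<exists>n\<in>I. \<exists>m\<in>I. S n \<noteq> S m")
    \<comment> \<open>With equal sums the difference of two quadratics is the constant
      \<open>D' n - D' m\<close>; a large prime makes it 0, and at most two pairs remain.\<close>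
    case False
    then have S: "S n = S m" if "n \<in> I" "m \<in> I" for n m using that by blast
    obtain p :: int where p: "prime p"
      "\<And>d. d \<in> (\<lambda>(n, m). D' n - D' m) ` (I \<times> I) \<Longrightarrow> p dvd d \<Longrightarrow> d = 0"
      using large_prime[of "(\<lambda>(n, m). D' n - D' m) ` (I \<times> I)"] fin by auto
    obtain x y :: nat and z where xyz: "p dvd int y - int x"
      "\<And>i. i \<in> I \<Longrightarrow> p dvd int (z i) - int x \<and>
      of_nat (z i) = a * of_nat x * of_nat y + B i * of_nat x + C i * of_nat y + B i * C i / a"
      using bilinear_regular_mod_prime[OF reg p(1)] by metis
    have D: "D' n = D' m" if "n \<in> I" "m \<in> I" for n m
    proof -
      have "p dvd (a' * int x * int x + (S n - c) * int x + D' n)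
                - (a' * int x * int x + (S m - c) * int x + D' m)"
        by (rule dvd_diff[OF root[of p y x z n, OF xyz(1) conjunct1[OF xyz(2)[OF that(1)]] that(1) conjunct2[OF xyz(2)[OF that(1)]]]
          root[of p y x z m, OF xyz(1) conjunct1[OF xyz(2)[OF that(2)]] that(2) conjunct2[OF xyz(2)[OF that(2)]]]])
      then have "p dvd D' n - D' m" using S[OF that] by simp
      then show ?thesis using p(2)[of "D' n - D' m"] that by force
    qed
    have "card ((\<lambda>n. (B n, C n)) ` I) \<le> 2"
    proof (rule card_same_sum_and_product)
      fix n m assume nm: "n \<in> I" "m \<in> I"
      have "of_int c * (B n + C n) = of_int c * (B m + C m)"
        using S[OF nm] B'C'D'[OF nm(1)] B'C'D'[OF nm(2)]
        by (simp add: S_def distrib_left flip: of_int_add)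
      moreover have "of_int c * (B n * C n / a) = of_int c * (B m * C m / a)"
        using D[OF nm] B'C'D'[OF nm(1)] B'C'D'[OF nm(2)] by simp
      ultimately show "B n + C n = B m + C m \<and> B n * C n = B m * C m" using c a by simp
    qed
    then show ?thesis using card by simp
  next
    case True
    then obtain i j where ij: "i \<in> I" "j \<in> I" "S i \<noteq> S j" by blast
    define b T where "b = S i - S j" and "T = D' j - D' i"
    have b: "b \<noteq> 0" using ij by (simp add: b_def)
    have dvd: "p dvd b * int x - T"
      if xyz: "p dvd int y - int x" "\<And>i. i \<in> I \<Longrightarrow> p dvd int (z i) - int x \<and>
        of_nat (z i) = a * of_nat x * of_nat y + B i * of_nat x + C i * of_nat y + B i * C i / a"
      for p :: int and x y and z :: "'a \<Rightarrow> nat"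
    proof -
      have "p dvd (a' * int x * int x + (S i - c) * int x + D' i)
                - (a' * int x * int x + (S j - c) * int x + D' j)"
        by (rule dvd_diff[OF root[of p y x z i, OF xyz(1) conjunct1[OF xyz(2)[OF ij(1)]] ij(1) conjunct2[OF xyz(2)[OF ij(1)]]]
          root[of p y x z j, OF xyz(1) conjunct1[OF xyz(2)[OF ij(2)]] ij(2) conjunct2[OF xyz(2)[OF ij(2)]]]])
      then show ?thesis by (simp add: b_def T_def algebra_simps)
    qed
    \<comment> \<open>\<open>Q n\<close> is \<open>b * b\<close> times the value of the quadratic of
      \<open>root\<close> at \<open>T / b\<close>.\<close>
    define Q where "Q n = a' * T * T + (S n - c) * T * b + D' n * b * b" for n
    obtain p :: int where p: "prime p" "\<And>d. d \<in> Q ` I \<Longrightarrow> p dvd d \<Longrightarrow> d = 0"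
      using large_prime[of "Q ` I"] fin by auto
    obtain x y :: nat and z where xyz: "p dvd int y - int x"
      "\<And>i. i \<in> I \<Longrightarrow> p dvd int (z i) - int x \<and>
      of_nat (z i) = a * of_nat x * of_nat y + B i * of_nat x + C i * of_nat y + B i * C i / a"
      using bilinear_regular_mod_prime[OF reg p(1)] by metis
    obtain h where "b * int x - T = p * h" using dvd[of p y x z, OF xyz] by blast
    then have h: "b * int x = T + p * h" by simp
    have Q0: "Q n = 0" if n: "n \<in> I" for n
    proof -
      have "p dvd b * b * (a' * int x * int x + (S n - c) * int x + D' n)"
        by (rule dvd_mult[OF root[of p y x z n, OF xyz(1) conjunct1[OF xyz(2)[OF n]] n conjunct2[OF xyz(2)[OF n]]]])
      also have "b * b * (a' * int x * int x + (S n - c) * int x + D' n) =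
          a' * (b * int x) * (b * int x) + (S n - c) * (b * int x) * b + D' n * b * b"
        by (simp add: algebra_simps)
      also have "\<dots> = Q n + p * (a' * h * (2 * T + p * h) + (S n - c) * h * b)"
        unfolding h Q_def by (simp add: algebra_simps)
      finally have "p dvd Q n" by (simp add: dvd_add_left_iff)
      then show ?thesis using p(2) n by blast
    qed
    have quad: "(a * (of_int T / of_int b) + B n) * (a * (of_int T / of_int b) + C n) = a * (of_int T / of_int b)"
      if n: "n \<in> I" for n
    proof -
      define t :: rat where "t = of_int T / of_int b"
      have T: "of_int T = t * of_int b" using b by (simp add: t_def)
      have "0 = (of_int (Q n) :: rat)" using Q0[OF n] by simp
      also have "\<dots> = of_int b * of_int b * of_int c * (a * t * t + (B n + C n - 1) * t + B n * C n / a)"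
        unfolding Q_def S_def of_int_add of_int_mult of_int_diff T a'[symmetric]
          B'C'D'[OF n, THEN conjunct1, symmetric]
          B'C'D'[OF n, THEN conjunct2, THEN conjunct1, symmetric]
          B'C'D'[OF n, THEN conjunct2, THEN conjunct2, symmetric]
        by (simp add: algebra_simps)
      finally have "a * t * t + (B n + C n - 1) * t + B n * C n / a = 0" using b c by simp
      moreover have "(a * t + B n) * (a * t + C n) - a * t =
          a * (a * t * t + (B n + C n - 1) * t + B n * C n / a)"
        using a by (simp add: algebra_simps)
      ultimately show ?thesis unfolding t_def[symmetric] by simp
    qed
    show ?thesis
    proof (rule that[OF b quad])
      fix p :: int and x y :: nat and z :: "'a \<Rightarrow> nat"
      assume yx: "p dvd int y - int x" and z: "\<And>i. i \<in> I \<Longrightarrow> p dvd int (z i) - int x \<and>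
        of_nat (z i) = a * of_nat x * of_nat y + B i * of_nat x + C i * of_nat y + B i * C i / a"
      show "p dvd b * int x - T" by (rule dvd[of p y x z, OF yx z])
    qed
  qed
qed

section \<open>Determination of the linear coefficients\<close>

text \<open>One colouring serves all indices, so the comparison of the valuations of
  \<open>e x\<close> and \<open>e y\<close> is the same for every term. For \<open>t = 0\<close> one
  of \<open>B n\<close>, \<open>C n\<close> vanishes and the other is 0 or 1; for
  \<open>t \<noteq> 0\<close> each outcome of the comparison leaves at most two pairs.\<close>

lemma bilinear_regular_coefficients:
  assumes reg: "bilinear_regular I (\<lambda>_. a) B C" and fin: "finite I"
    and card: "card ((\<lambda>n. (B n, C n)) ` I) \<ge> 3" and a: "a > 0" and n: "n \<in> I"
  shows "(B n, C n) \<in> {(0, 0), (1, 0), (0, 1)}"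
proof -
  obtain b T :: int where b: "b \<noteq> 0"
    and quad: "\<And>n. n \<in> I \<Longrightarrow> (a * (of_int T / of_int b) + B n) * (a * (of_int T / of_int b) + C n)
        = a * (of_int T / of_int b)"
    and residue: "\<And>(p :: int) (x :: nat) (y :: nat) z. prime p \<Longrightarrow> p dvd int y - int x \<Longrightarrow>
      (\<And>i. i \<in> I \<Longrightarrow> p dvd int (z i) - int x \<and>
        of_nat (z i) = a * of_nat x * of_nat y + B i * of_nat x + C i * of_nat y + B i * C i / a) \<Longrightarrow>
      p dvd b * int x - T"
    using bilinear_regular_residue[OF reg fin card a] by metis
  define t :: rat where "t = of_int T / of_int b"
  have T: "of_int T = of_int b * t" using b by (simp add: t_def)
  define \<beta> \<gamma> where "\<beta> n = a * t + B n" and "\<gamma> n = a * t + C n" for n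
  have \<beta>\<gamma>: "\<beta> n * \<gamma> n = a * t" if "n \<in> I" for n
    using quad[OF that] by (simp add: \<beta>_def \<gamma>_def t_def)
  obtain c :: int where c: "c > 0"
    and cd: "\<And>q. q \<in> insert (a / of_int b) (\<Union>n\<in>I. {\<beta> n, \<gamma> n}) \<Longrightarrow> of_int c * q \<in> \<int>"
    using common_denominator[of "insert (a / of_int b) (\<Union>n\<in>I. {\<beta> n, \<gamma> n})"] fin by auto
  define \<alpha>' \<beta>' \<gamma>' where "\<alpha>' = \<lfloor>of_int c * (a / of_int b)\<rfloor>" and "\<beta>' n = \<lfloor>of_int c * \<beta> n\<rfloor>"
    and "\<gamma>' n = \<lfloor>of_int c * \<gamma> n\<rfloor>" for n
  have \<alpha>': "of_int \<alpha>' = of_int c * (a / of_int b)"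
    unfolding \<alpha>'_def by (rule of_int_floor, rule cd) simp
  have \<beta>': "of_int (\<beta>' n) = of_int c * \<beta> n" and \<gamma>': "of_int (\<gamma>' n) = of_int c * \<gamma> n" if "n \<in> I" for n
    unfolding \<beta>'_def \<gamma>'_def by (rule of_int_floor, rule cd, use that in blast)+
  have "(of_int \<alpha>' :: rat) \<noteq> 0" unfolding \<alpha>' using a b c by simp
  then have \<alpha>'0: "\<alpha>' \<noteq> 0" by simp
  \<comment> \<open>These are the integers for which divisibility by \<open>p\<close> has to mean
    vanishing.\<close>
  define L where "L = {c, \<alpha>'} \<union>
    (\<Union>n\<in>I. {\<beta>' n, \<gamma>' n, c - \<beta>' n, c - \<gamma>' n, \<beta>' n + \<gamma>' n, c - (\<beta>' n + \<gamma>' n)})"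
  have "finite L" unfolding L_def using fin by simp
  then obtain p :: int where p: "prime p" and large: "\<And>d. d \<in> L \<Longrightarrow> p dvd d \<Longrightarrow> d = 0"
    using large_prime by blast
  define N where "N = (c + (\<Sum>n\<in>I. \<bar>\<beta>' n\<bar>)) * p"
  have p0: "p > 0" using p prime_gt_0_int by blast
  have N: "N \<ge> (c + \<bar>\<beta>' n\<bar>) * p" if "n \<in> I" for n
    unfolding N_def using member_le_sum[of n I "\<lambda>n. \<bar>\<beta>' n\<bar>"] that fin p0
    by (intro mult_right_mono) auto
  have N0: "N \<ge> 0" unfolding N_def using c p0 by (simp add: sum_nonneg)
  \<comment> \<open>This is \<open>b * (x - t)\<close>, the shift by \<open>t\<close> made integral.
    The product \<open>e x * e y\<close> carries one more factor \<open>b\<close> than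
    \<open>e (z n)\<close>, whence \<open>a / b\<close> in \<open>\<alpha>'\<close>.\<close>
  define e :: "nat \<Rightarrow> int" where "e x = b * int x - T" for x
  \<comment> \<open>The residue modulo \<open>p\<close> is included so that \<open>residue\<close>
    makes \<open>p\<close> divide \<open>e x\<close> and \<open>e y\<close>.\<close>
  define f :: "nat \<Rightarrow> int \<times> int \<times> int"
    where "f x = (int x mod p, leading_digit p (e x), scaled_residue p N (e x))" for x
  have "scaled_residue p N E \<in> {0..N}" for E
  proof -
    define m where "m = p ^ (2 * multiplicity p E + 1)"
    have m: "m > 0" using p0 by (simp add: m_def)
    have "N * (E mod m) \<le> N * m" using m N0 by (intro mult_left_mono) (auto intro: less_imp_le)
    then have "N * (E mod m) div m \<le> N * m div m" using m by (intro zdiv_mono1)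
    moreover have "N * (E mod m) div m \<ge> 0" using m N0 by (simp add: pos_imp_zdiv_nonneg_iff)
    moreover have "N * m div m = N" using m by simp
    ultimately show ?thesis unfolding scaled_residue_def m_def[symmetric] by simp
  qed
  then have "range f \<subseteq> {0..<p} \<times> {0..<p} \<times> {0..N}"
    using p0 by (auto simp: f_def leading_digit_def)
  then have "finite (range f)" by (rule finite_subset) simp
  \<comment> \<open>Entries above the absolute value of \<open>T\<close> have nonzero
    \<open>e\<close>, so leading digits are meaningful.\<close>
  then obtain x y z where xy: "x > nat \<bar>T\<bar>" "y > nat \<bar>T\<bar>" "f y = f x" and z: "\<And>i. i \<in> I \<Longrightarrow>
      z i > nat \<bar>T\<bar> \<and> f (z i) = f x \<and>
      of_nat (z i) = a * of_nat x * of_nat y + B i * of_nat x + C i * of_nat y + B i * C i / a"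
    using reg unfolding bilinear_regular_def by metis
  have e0: "e w \<noteq> 0" if "w > nat \<bar>T\<bar>" for w
  proof
    assume "e w = 0"
    then have "\<bar>b * int w\<bar> = \<bar>T\<bar>" by (simp add: e_def)
    then have "\<bar>b\<bar> * int w = \<bar>T\<bar>" by (simp add: abs_mult)
    moreover have "1 * int w \<le> \<bar>b\<bar> * int w" using b by (intro mult_right_mono) auto
    ultimately show False using that by linarith
  qed
  have yx: "p dvd int y - int x" using xy(3) by (simp add: f_def mod_eq_dvd_iff)
  have "p dvd int (z i) - int x" if "i \<in> I" for i
    using z[OF that] by (simp add: f_def mod_eq_dvd_iff)
  then have ex: "p dvd e x" unfolding e_def using z by (intro residue[OF p yx]) blast
  have "e y = e x + b * (int y - int x)" by (simp add: e_def algebra_simps)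
  then have ey: "p dvd e y" using ex yx by simp
  have lin: "c * e (z n) = \<beta>' n * e x + \<gamma>' n * e y + \<alpha>' * e x * e y" if n: "n \<in> I" for n
  proof -
    have e: "of_int (e w) = of_int b * (of_nat w - t)" for w by (simp add: e_def T algebra_simps)
    \<comment> \<open>The relation \<open>\<beta> n * \<gamma> n = a * t\<close> absorbs the
      constant \<open>B n * C n / a\<close>, so no constant survives the shift.\<close>
    have "a * (of_nat (z n) - t) = a * of_nat (z n) - \<beta> n * \<gamma> n"
      using \<beta>\<gamma>[OF n] by (simp add: algebra_simps)
    also have "\<dots> = a * (\<beta> n * (of_nat x - t) + \<gamma> n * (of_nat y - t) + a * (of_nat x - t) * (of_nat y - t))"
      using a z[OF n] by (simp add: \<beta>_def \<gamma>_def algebra_simps)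
    finally have zt: "of_nat (z n) - t =
        \<beta> n * (of_nat x - t) + \<gamma> n * (of_nat y - t) + a * (of_nat x - t) * (of_nat y - t)"
      using a by simp
    have "(of_int (c * e (z n)) :: rat) = of_int (\<beta>' n * e x + \<gamma>' n * e y + \<alpha>' * e x * e y)"
      unfolding of_int_mult of_int_add e \<alpha>' \<beta>'[OF n] \<gamma>'[OF n] zt using b by (simp add: algebra_simps)
    then show ?thesis by (simp only: of_int_eq_iff)
  qed
  have digits: "leading_digit p (e x) = leading_digit p (e y)"
    "scaled_residue p N (e x) = scaled_residue p N (e y)"
    "\<And>n. n \<in> I \<Longrightarrow> leading_digit p (e (z n)) = leading_digit p (e y)"
    "\<And>n. n \<in> I \<Longrightarrow> scaled_residue p N (e (z n)) = scaled_residue p N (e y)"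
    using xy(3) z by (auto simp: f_def)
  have ndvd: "\<not> p dvd c" "\<not> p dvd \<alpha>'" using large[of c] large[of \<alpha>'] c \<alpha>'0 by (auto simp: L_def)
  have zero: "\<beta>' n = 0 \<longleftrightarrow> \<beta> n = 0" "\<gamma>' n = 0 \<longleftrightarrow> \<gamma> n = 0"
    and one: "\<beta>' n = c \<longleftrightarrow> \<beta> n = 1" "\<gamma>' n = c \<longleftrightarrow> \<gamma> n = 1"
    and opp: "\<beta>' n + \<gamma>' n = 0 \<longleftrightarrow> \<beta> n + \<gamma> n = 0" if n: "n \<in> I" for n
  proof -
    have 1: "u = v \<longleftrightarrow> (of_int u :: rat) = of_int v" for u v :: int by simp
    show "\<beta>' n = 0 \<longleftrightarrow> \<beta> n = 0" "\<gamma>' n = 0 \<longleftrightarrow> \<gamma> n = 0" "\<beta>' n = c \<longleftrightarrow> \<beta> n = 1" "\<gamma>' n = c \<longleftrightarrow> \<gamma> n = 1"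
      unfolding 1 \<beta>'[OF n] \<gamma>'[OF n] using c by simp_all
    have "of_int c * \<beta> n + of_int c * \<gamma> n = of_int c * (\<beta> n + \<gamma> n)" by (simp add: distrib_left)
    then show "\<beta>' n + \<gamma>' n = 0 \<longleftrightarrow> \<beta> n + \<gamma> n = 0"
      unfolding 1 of_int_add \<beta>'[OF n] \<gamma>'[OF n] using c by simp
  qed
  have key: "\<gamma> n = 0 \<Longrightarrow> \<beta> n \<noteq> 0 \<Longrightarrow> \<beta> n = 1"
    "\<beta> n = 0 \<Longrightarrow> \<gamma> n \<noteq> 0 \<Longrightarrow> \<gamma> n = 1"
    "\<beta> n \<noteq> 0 \<Longrightarrow> \<gamma> n \<noteq> 0 \<Longrightarrow> multiplicity p (e x) < multiplicity p (e y) \<Longrightarrow> \<beta> n = 1"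
    "\<beta> n \<noteq> 0 \<Longrightarrow> \<gamma> n \<noteq> 0 \<Longrightarrow> multiplicity p (e y) < multiplicity p (e x) \<Longrightarrow> \<gamma> n = 1"
    "\<beta> n \<noteq> 0 \<Longrightarrow> \<gamma> n \<noteq> 0 \<Longrightarrow> multiplicity p (e x) = multiplicity p (e y) \<Longrightarrow> \<beta> n + \<gamma> n = 0"
    if n: "n \<in> I" for n
  proof -
    have "d = 0" if "d \<in> {\<beta>' n, \<gamma>' n, c - \<beta>' n, c - \<gamma>' n, \<beta>' n + \<gamma>' n, c - (\<beta>' n + \<gamma>' n)}" "p dvd d" for d
      using large[of d] that n unfolding L_def by blast
    note * = bilinear_leading_digits[OF p c ndvd this e0[OF xy(1)] e0[OF xy(2)] e0[OF conjunct1[OF z[OF n]]]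
      ex ey lin[OF n] digits(1) digits(3)[OF n] digits(2) digits(4)[OF n] N[OF n]]
    show "\<gamma> n = 0 \<Longrightarrow> \<beta> n \<noteq> 0 \<Longrightarrow> \<beta> n = 1"
      "\<beta> n = 0 \<Longrightarrow> \<gamma> n \<noteq> 0 \<Longrightarrow> \<gamma> n = 1"
      "\<beta> n \<noteq> 0 \<Longrightarrow> \<gamma> n \<noteq> 0 \<Longrightarrow> multiplicity p (e x) < multiplicity p (e y) \<Longrightarrow> \<beta> n = 1"
      "\<beta> n \<noteq> 0 \<Longrightarrow> \<gamma> n \<noteq> 0 \<Longrightarrow> multiplicity p (e y) < multiplicity p (e x) \<Longrightarrow> \<gamma> n = 1"
      "\<beta> n \<noteq> 0 \<Longrightarrow> \<gamma> n \<noteq> 0 \<Longrightarrow> multiplicity p (e x) = multiplicity p (e y) \<Longrightarrow> \<beta> n + \<gamma> n = 0"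
      using * unfolding zero[OF n] one[OF n] opp[OF n] by blast+
  qed
  show ?thesis
  proof (cases "t = 0")
    case True
    then show ?thesis using \<beta>\<gamma>[OF n] key(1,2)[OF n] by (auto simp: \<beta>_def \<gamma>_def)
  next
    case False
    then have nz: "\<beta> n \<noteq> 0" "\<gamma> n \<noteq> 0" if "n \<in> I" for n
      using \<beta>\<gamma>[OF that] a by auto
    have "B n + C n = B m + C m \<and> B n * C n = B m * C m" if nm: "n \<in> I" "m \<in> I" for n m
    proof (cases "multiplicity p (e x)" "multiplicity p (e y)" rule: linorder_cases)
      case less
      then have "\<beta> n = 1" "\<beta> m = 1" using key(3) nz nm by blast+
      then have "\<beta> n = \<beta> m" "\<gamma> n = \<gamma> m" using \<beta>\<gamma>[OF nm(1)] \<beta>\<gamma>[OF nm(2)] by simp_all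
      then show ?thesis by (simp add: \<beta>_def \<gamma>_def)
    next
      case greater
      then have "\<gamma> n = 1" "\<gamma> m = 1" using key(4) nz nm by blast+
      then have "\<beta> n = \<beta> m" "\<gamma> n = \<gamma> m" using \<beta>\<gamma>[OF nm(1)] \<beta>\<gamma>[OF nm(2)] by simp_all
      then show ?thesis by (simp add: \<beta>_def \<gamma>_def)
    next
      case equal
      then have "\<beta> n + \<gamma> n = 0" "\<beta> m + \<gamma> m = 0" using key(5) nz nm by blast+
      then have sum: "B n + C n = B m + C m" by (simp add: \<beta>_def \<gamma>_def algebra_simps)
      \<comment> \<open>Sum and product of \<open>\<beta> k\<close>, \<open>\<gamma> k\<close> are
        both fixed here; shifting by \<open>a * t\<close> back to \<open>B k\<close>,
        \<open>C k\<close> preserves this.\<close>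
      have "B k * C k = \<beta> k * \<gamma> k - a * t * (B k + C k) - a * t * (a * t)" for k
        by (simp add: \<beta>_def \<gamma>_def algebra_simps)
      then show ?thesis using \<beta>\<gamma>[OF nm(1)] \<beta>\<gamma>[OF nm(2)] sum by simp
    qed
    then have "card ((\<lambda>n. (B n, C n)) ` I) \<le> 2" by (rule card_same_sum_and_product)
    then show ?thesis using card by simp
  qed
qed

subsection \<open>Patterns\<close>

lemma partition_regular_function:
  assumes reg: "partition_regular fs" and fin: "finite (range f)"
  shows "infinite {t. \<exists>u>0. \<exists>v>0. t = map (\<lambda>g. g u v) fs \<and>
    (\<exists>c. set t \<subseteq> of_nat ` {n. n > 0 \<and> f n = c})}"
proof -
  define \<C> where "\<C> = (\<lambda>c. {n. n > 0 \<and> f n = c}) ` f ` {0<..}"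
  have "finite \<C>" 
    unfolding \<C>_def by (intro finite_imageI rev_finite_subset[OF fin, of "f ` {0<..}"]) auto
  moreover have "partition_on {0<..} \<C>"
    unfolding \<C>_def by (rule partition_onI) (auto simp: disjnt_def)
  ultimately have "finite_colouring \<C>" by (simp add: finite_colouring_def)
  then have "infinite {t. \<exists>u>0. \<exists>v>0. t = map (\<lambda>g. g u v) fs \<and> monochromatic \<C> t}"
    using reg unfolding partition_regular_def by blast
  then show ?thesis
    by (rule contrapos_nn, elim finite_subset[rotated]) (auto simp: monochromatic_def \<C>_def)
qed

text \<open>Infinitely many tuples cannot all come from \<open>u\<close> and \<open>v\<close> up to
  \<open>N\<close>. Adding \<open>min n (Suc N)\<close> to the colour then lifts every entry above
  \<open>N\<close> as soon as one of \<open>u\<close>, \<open>v\<close> is.\<close>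

lemma polynomial_pattern_regular_solution:
  fixes f :: "nat \<Rightarrow> 'a"
  assumes reg: "polynomial_pattern_regular (X # Y # ps)" and fin: "finite (range f)"
  shows "\<exists>x>N. \<exists>y>N. f y = f x \<and> (\<forall>p\<in>set ps. \<exists>z>N. f z = f x \<and> eval p x y = of_nat z)"
proof -
  define g where "g n = (f n, min n (Suc N))" for n
  have "range g \<subseteq> range f \<times> {..Suc N}" by (auto simp: g_def)
  then have "finite (range g)" by (rule finite_subset) (simp add: fin)
  then have "infinite {t. \<exists>u>0. \<exists>v>0. t = map (\<lambda>h. h u v) (map eval (X # Y # ps)) \<and>
    (\<exists>c. set t \<subseteq> of_nat ` {n. n > 0 \<and> g n = c})}" (is "infinite ?S")
    using reg unfolding polynomial_pattern_regular_def by (intro partition_regular_function)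
  moreover have "finite ((\<lambda>(u, v). map (\<lambda>h. h u v) (map eval (X # Y # ps))) ` ({..N} \<times> {..N}))"
    by simp
  ultimately obtain t where "t \<in> ?S"
    and t: "t \<notin> (\<lambda>(u, v). map (\<lambda>h. h u v) (map eval (X # Y # ps))) ` ({..N} \<times> {..N})"
    by (meson finite_subset subsetI)
  then obtain u v c where uv: "t = map (\<lambda>h. h u v) (map eval (X # Y # ps))"
    "set t \<subseteq> of_nat ` {n. n > 0 \<and> g n = c}" by blast
  have sub: "\<exists>n. w = of_nat n \<and> g n = c" if "w \<in> set t" for w using uv(2) that by auto
  have "of_nat u \<in> set t" "of_nat v \<in> set t" using uv(1) by simp_all
  then have g: "g u = c" "g v = c" using sub by fastforce+
  have "\<not> (u \<le> N \<and> v \<le> N)" using t uv(1) by auto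
  then have N: "u > N" "v > N" using g by (auto simp: g_def min_def split: if_splits)
  have "\<exists>z>N. f z = f u \<and> eval p u v = of_nat z" if "p \<in> set ps" for p
  proof -
    have "eval p u v \<in> set t" using uv(1) that by simp
    then obtain z where z: "eval p u v = of_nat z" "g z = c" using sub by blast
    then have "f z = f u" "min z (Suc N) = min u (Suc N)" using g by (auto simp: g_def)
    then show ?thesis using z N by (intro exI[of _ z]) auto
  qed
  moreover have "f v = f u" using g by (auto simp: g_def)
  ultimately show ?thesis using N by blast
qed

section \<open>The canonical pattern and the change of its parameter\<close>

definition canonical_pattern :: "rat \<Rightarrow> bipoly list" where
  "canonical_pattern r = [X, Y, Const r * X * Y, Const r * X * Y + X, Const r * X * Y + Y]"

text \<open>
  The entries are multiplied by \<open>r / r'\<close>. This is integral because a colouring modulo \<open>e\<close> gives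
  the entries \<open>r x y\<close> and \<open>r x y + x\<close> the same residue, so that \<open>e\<close> divides \<open>x\<close> and every entry.
\<close>

lemma canonical_pattern_rescale:
  assumes reg: "polynomial_pattern_regular (canonical_pattern r)" and r: "r > 0" "r' > 0"
  shows "polynomial_pattern_regular (canonical_pattern r')"
  unfolding polynomial_pattern_regular_def partition_regular_def
proof (intro allI impI)
  fix \<C> assume "finite_colouring \<C>"
  then have fin: "finite \<C>" and part: "partition_on {0<..} \<C>" by (auto simp: finite_colouring_def)
  define s where "s = r / r'"
  have "s > 0" using r by (simp add: s_def)
  obtain m d where s: "s = Fract m d" "d > 0" by (cases s) auto
  define c e where "c = nat m" and "e = nat d"
  have "m > 0" using \<open>s > 0\<close> s by (simp add: zero_less_Fract_iff)
  then have ce: "c > 0" "e > 0" "s = of_nat c / of_nat e"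
    using s by (simp_all add: c_def e_def Fract_of_int_quotient)
  define cls where "cls n = (THE A. A \<in> \<C> \<and> n \<in> A)" for n
  have cls: "cls n \<in> \<C>" "n \<in> cls n" if "n > 0" for n
  proof -
    have "\<exists>A\<in>\<C>. n \<in> A" using part that by (auto simp: partition_on_def)
    moreover have "A = A'" if "A \<in> \<C>" "A' \<in> \<C>" "n \<in> A" "n \<in> A'" for A A'
      using partition_onD2[OF part] that by (meson disjointD disjoint_iff)
    ultimately have "\<exists>!A. A \<in> \<C> \<and> n \<in> A" by blast
    then show "cls n \<in> \<C>" "n \<in> cls n" unfolding cls_def by (metis (mono_tags, lifting) theI')+
  qed
  \<comment> \<open>If \<open>e\<close> divides \<open>n\<close>, then \<open>n div e * c\<close> is
    \<open>s * n\<close>, so the given colouring is pulled back along multiplication by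
    \<open>s\<close>.\<close>
  define f where "f n = (cls (n div e * c), n mod e)" for n
  \<comment> \<open>For \<open>n < e\<close> the argument of \<open>cls\<close> is 0, which lies in
    no class; its unspecified value is added to keep the range finite.\<close>
  have "cls n \<in> insert (cls 0) \<C>" for n using cls by (cases "n = 0") auto
  then have "range f \<subseteq> insert (cls 0) \<C> \<times> {..<e}" using ce by (auto simp: f_def)
  then have "finite (range f)" by (rule finite_subset) (simp add: fin)
  then have inf: "infinite {t. \<exists>u>0. \<exists>v>0. t = map (\<lambda>h. h u v) (map eval (canonical_pattern r)) \<and>
    (\<exists>c. set t \<subseteq> of_nat ` {n. n > 0 \<and> f n = c})}" (is "infinite ?S")
    using reg unfolding polynomial_pattern_regular_def by (intro partition_regular_function)
  have "inj (map ((*) s))" using \<open>s > 0\<close> by (intro inj_mapI injI) simp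
  then have "inj_on (map ((*) s)) ?S" by (rule inj_on_subset) simp
  from finite_imageD[OF _ this] have "infinite (map ((*) s) ` ?S)" using inf by blast
  moreover have "map ((*) s) ` ?S \<subseteq> {t. \<exists>u>0. \<exists>v>0. t = map (\<lambda>h. h u v) (map eval (canonical_pattern r')) \<and>
      monochromatic \<C> t}"
  proof (rule image_subsetI)
    fix t assume "t \<in> ?S"
    then obtain u v k where uv: "u > 0" "v > 0" "t = map (\<lambda>h. h u v) (map eval (canonical_pattern r))"
      and sub: "set t \<subseteq> of_nat ` {n. n > 0 \<and> f n = k}" by blast
    have t: "t = [of_nat u, of_nat v, r * of_nat u * of_nat v, r * of_nat u * of_nat v + of_nat u,
        r * of_nat u * of_nat v + of_nat v]"
      using uv(3) by (simp add: canonical_pattern_def)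
    have colour: "\<exists>n. w = of_nat n \<and> f n = k" if "w \<in> set t" for w using sub that by auto
    have members: "of_nat u \<in> set t" "of_nat v \<in> set t" "r * of_nat u * of_nat v \<in> set t"
      "r * of_nat u * of_nat v + of_nat u \<in> set t" by (simp_all add: t)
    obtain n n' where n: "r * of_nat u * of_nat v = of_nat n" "f n = k"
      "r * of_nat u * of_nat v + of_nat u = of_nat n'" "f n' = k"
      using colour members by meson
    have "of_nat n' = (of_nat (n + u) :: rat)" using n(1,3) by simp
    then have "n' = n + u" by (simp only: of_nat_eq_iff)
    then have "(n + u) mod e = n mod e" using n(2,4) by (auto simp: f_def)
    then have "e dvd u" by (metis add_diff_cancel_left' mod_eq_dvd_iff_nat le_add1)
    moreover have "f u = k" using colour[OF members(1)] by auto
    ultimately have k: "snd k = 0" by (auto simp: f_def)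
    have scale: "\<exists>n>0. s * w = of_nat n \<and> n \<in> fst k" and "fst k \<in> \<C>" if w: "w \<in> set t" for w
    proof -
      obtain n where n: "w = of_nat n" "n > 0" "f n = k" using sub w by auto
      then have "e dvd n" using k by (auto simp: f_def)
      then obtain h where h: "n = e * h" by blast
      have "h * c > 0" using n(2) h ce by simp
      moreover have "s * w = of_nat (h * c)" using ce by (simp add: n(1) h)
      moreover have "fst k = cls (h * c)" using n(3) h ce by (auto simp: f_def)
      ultimately show "\<exists>n>0. s * w = of_nat n \<and> n \<in> fst k" "fst k \<in> \<C>"
        using cls by metis+
    qed
    obtain u' v' where u'v': "u' > 0" "s * of_nat u = of_nat u'" "v' > 0" "s * of_nat v = of_nat v'"
      using scale[OF members(1)] scale[OF members(2)] by blast
    \<comment> \<open>Scaling both variables by \<open>s\<close> scales the product by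
      \<open>s * s\<close>; one factor turns \<open>r'\<close> into \<open>r\<close>.\<close>
    have "r = r' * s" using r by (simp add: s_def)
    then have "s * (r * of_nat u * of_nat v) = r' * (s * of_nat u) * (s * of_nat v)"
      by (simp only: mult_ac)
    then have "map ((*) s) t = map (\<lambda>h. h u' v') (map eval (canonical_pattern r'))"
      by (simp add: t canonical_pattern_def distrib_left u'v')
    moreover have "monochromatic \<C> (map ((*) s) t)"
      unfolding monochromatic_def
    proof
      show "set (map ((*) s) t) \<subseteq> of_nat ` fst k" using scale by fastforce
      show "fst k \<in> \<C>" using \<open>\<And>w. w \<in> set t \<Longrightarrow> fst k \<in> \<C>\<close>[OF members(1)] .
    qed
    ultimately show "map ((*) s) t \<in> {t. \<exists>u>0. \<exists>v>0.
        t = map (\<lambda>h. h u v) (map eval (canonical_pattern r')) \<and> monochromatic \<C> t}"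
      using u'v'(1,3) by blast
  qed
  ultimately show "infinite {t. \<exists>u>0. \<exists>v>0. t = map (\<lambda>h. h u v) (map eval (canonical_pattern r')) \<and>
      monochromatic \<C> t}"
    by (rule infinite_super[rotated])
qed

lemma canonical_pattern_1: "canonical_pattern 1 = [X, Y, X * Y, X * Y + X, X * Y + Y]"
proof -
  have "Const 1 = 1" by (simp add: Const_def one_pCons)
  then show ?thesis by (simp add: canonical_pattern_def)
qed

section \<open>From bilinear terms to the canonical pattern\<close>

lemma bilinear_term_expand:
  "bilinear_term q a n b m = Const (q * of_nat a * of_nat b) * X * Y + Const (q * of_nat a * of_int m) * X
     + Const (q * of_nat b * of_int n) * Y + Const (q * of_int n * of_int m)"
proof -
  have hom: "Const (c * d) = Const c * Const d" "of_nat k = Const (of_nat k)" "of_int i = Const (of_int i)"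
    for c d k i
    by (simp_all add: Const_def of_nat_poly of_int_poly)
  show ?thesis unfolding bilinear_term_def hom by (simp add: algebra_simps)
qed

text \<open>Every term lies in a canonical pattern, which has at most five elements. Hence
  \<open>k + 2 \<le> 5\<close>, and the cardinality assumption turns the inclusion of sets into
  equality.\<close>

lemma bilinear_patterns:
  fixes q :: "nat \<Rightarrow> rat" and a b :: "nat \<Rightarrow> nat" and n m :: "nat \<Rightarrow> int"
  defines "F \<equiv> \<lambda>i. bilinear_term (q i) (a i) (n i) (b i) (m i)"
  assumes pos: "\<forall>i\<in>{1..k}. q i > 0 \<and> a i > 0 \<and> b i > 0"
    and card: "card ({X, Y} \<union> F ` {1..k}) = k + 2" and k: "k + 2 \<ge> 5"
    and reg: "polynomial_pattern_regular (X # Y # map F [1..<Suc k])"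
  shows "k = 3 \<and> (\<exists>r>0. {X, Y} \<union> F ` {1..k} = set (canonical_pattern r))"
proof -
  define I where "I = {1..k}"
  define A B C where "A i = q i * of_nat (a i) * of_nat (b i)" and "B i = q i * of_nat (a i) * of_int (m i)"
    and "C i = q i * of_nat (b i) * of_int (n i)" for i
  have A: "A i > 0" if "i \<in> I" for i using pos that by (simp add: A_def I_def)
  have F: "F i = Const (A i) * X * Y + Const (B i) * X + Const (C i) * Y + Const (B i * C i / A i)"
    if i: "i \<in> I" for i
  proof -
    have "q i > 0" "a i > 0" "b i > 0" using i pos by (simp_all add: I_def)
    then have "q i * of_int (n i) * of_int (m i) = B i * C i / A i"
      by (simp add: A_def B_def C_def field_simps)
    then show ?thesis unfolding F_def bilinear_term_expand A_def B_def C_def by simp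
  qed
  have breg: "bilinear_regular I A B C"
    unfolding bilinear_regular_def
  proof (intro allI impI)
    fix f :: "nat \<Rightarrow> int \<times> int \<times> int" and N assume "finite (range f)"
    from polynomial_pattern_regular_solution[OF reg this, of N] obtain x y where xy: "x > N" "y > N" "f y = f x"
      and "\<forall>p\<in>set (map F [1..<Suc k]). \<exists>z>N. f z = f x \<and> eval p x y = of_nat z" by blast
    then have "\<forall>i\<in>I. \<exists>z>N. f z = f x \<and> eval (F i) x y = of_nat z"
      by (auto simp: I_def)
    then obtain z where "\<forall>i\<in>I. z i > N \<and> f (z i) = f x \<and> eval (F i) x y = of_nat (z i)"
      by metis
    moreover have "eval (F i) x y =
        A i * of_nat x * of_nat y + B i * of_nat x + C i * of_nat y + B i * C i / A i" if "i \<in> I" for i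
      unfolding F[OF that] by simp
    ultimately have "\<forall>i\<in>I. z i > N \<and> f (z i) = f x \<and>
        of_nat (z i) = A i * of_nat x * of_nat y + B i * of_nat x + C i * of_nat y + B i * C i / A i"
      by metis
    then show "\<exists>x>N. \<exists>y>N. f y = f x \<and> (\<exists>z. \<forall>i\<in>I. z i > N \<and> f (z i) = f x \<and>
        of_nat (z i) = A i * of_nat x * of_nat y + B i * of_nat x + C i * of_nat y + B i * C i / A i)"
      using xy by blast
  qed
  define r where "r = A 1"
  have I1: "1 \<in> I" using k by (simp add: I_def)
  have Ar: "A i = r" if "i \<in> I" for i
    unfolding r_def using bilinear_regular_leading_le[OF breg] that I1 A by (meson order_antisym)
  have r: "r > 0" using A[OF I1] by (simp add: r_def)
  \<comment> \<open>With a common leading coefficient, a term is a function of the pair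
    \<open>(B i, C i)\<close>, so three distinct terms give three distinct pairs.\<close>
  have Fr: "F i = (\<lambda>(B, C). Const r * X * Y + Const B * X + Const C * Y + Const (B * C / r)) (B i, C i)"
    if "i \<in> I" for i using F[OF that] Ar[OF that] by simp
  have "k + 2 \<le> card {X, Y} + card (F ` I)" using card card_Un_le[of "{X, Y}" "F ` I"] by (simp add: I_def)
  moreover have "card {X, Y} \<le> 2" by (simp add: card_insert_if)
  ultimately have "card (F ` I) \<ge> 3" using k by linarith
  also have "F ` I = (\<lambda>(B, C). Const r * X * Y + Const B * X + Const C * Y + Const (B * C / r)) ` (\<lambda>i. (B i, C i)) ` I"
    unfolding image_image using Fr by (intro image_cong) auto
  also have "card \<dots> \<le> card ((\<lambda>i. (B i, C i)) ` I)" by (intro card_image_le) (simp add: I_def)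
  finally have card3: "card ((\<lambda>i. (B i, C i)) ` I) \<ge> 3" .
  have breg': "bilinear_regular I (\<lambda>_. r) B C" using breg Ar by (simp add: bilinear_regular_def)
  have Const01: "Const 0 = 0" "Const 1 = 1" by (simp_all add: Const_def one_pCons)
  have "F i \<in> set (canonical_pattern r)" if i: "i \<in> I" for i
  proof -
    have "(B i, C i) \<in> {(0, 0), (1, 0), (0, 1)}"
      by (rule bilinear_regular_coefficients[OF breg' _ card3 r i]) (simp add: I_def)
    then show ?thesis using Fr[OF i] by (auto simp: canonical_pattern_def Const01)
  qed
  then have sub: "{X, Y} \<union> F ` I \<subseteq> set (canonical_pattern r)" by (auto simp: canonical_pattern_def)
  have len: "card (set (canonical_pattern r)) \<le> 5"
    using card_length[of "canonical_pattern r"] by (simp add: canonical_pattern_def)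
  have "k + 2 \<le> 5" using card_mono[OF _ sub] card len by (simp add: I_def)
  then have "k = 3" using k by simp
  moreover have "{X, Y} \<union> F ` I = set (canonical_pattern r)"
    using card len \<open>k = 3\<close> by (intro card_seteq sub) (simp_all add: I_def)
  ultimately show ?thesis using r unfolding I_def by blast
qed

theorem corollaryE:
  "(\<forall>(k::nat) (q :: nat \<Rightarrow> rat) (a :: nat \<Rightarrow> nat) (b :: nat \<Rightarrow> nat) (n :: nat \<Rightarrow> int) (m :: nat \<Rightarrow> int).
      k > 0 \<longrightarrow>
      (\<forall>i\<in>{1..k}. q i > 0 \<and> a i > 0 \<and> b i > 0) \<longrightarrow>
      card ({X, Y} \<union> {bilinear_term (q i) (a i) (n i) (b i) (m i) | i. i \<in> {1..k}}) = k + 2 \<longrightarrow>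
      k + 2 \<ge> 5 \<longrightarrow>
      polynomial_pattern_regular
        (X # Y # map (\<lambda>i. bilinear_term (q i) (a i) (n i) (b i) (m i)) [1..<Suc k]) \<longrightarrow>
      k = 3 \<and>
      (\<exists>r::rat. r > 0 \<and>
         {X, Y} \<union> {bilinear_term (q i) (a i) (n i) (b i) (m i) | i. i \<in> {1..k}} =
         {X, Y, Const r * X * Y, Const r * X * Y + X, Const r * X * Y + Y}))
   \<and>
   (\<forall>r::rat. r > 0 \<longrightarrow>
      polynomial_pattern_regular
        [X, Y, Const r * X * Y, Const r * X * Y + X, Const r * X * Y + Y] \<longleftrightarrow>
      polynomial_pattern_regular
        [X, Y, X * Y, X * Y + X, X * Y + Y])"
proof (intro conjI allI impI)
  fix k and q :: "nat \<Rightarrow> rat" and a b :: "nat \<Rightarrow> nat" and n m :: "nat \<Rightarrow> int"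
  let ?F = "\<lambda>i. bilinear_term (q i) (a i) (n i) (b i) (m i)"
  assume *: "\<forall>i\<in>{1..k}. q i > 0 \<and> a i > 0 \<and> b i > 0"
    "card ({X, Y} \<union> {?F i | i. i \<in> {1..k}}) = k + 2" "k + 2 \<ge> 5"
    "polynomial_pattern_regular (X # Y # map ?F [1..<Suc k])"
  have image: "{?F i | i. i \<in> {1..k}} = ?F ` {1..k}" by blast
  have "k = 3 \<and> (\<exists>r>0. {X, Y} \<union> {?F i | i. i \<in> {1..k}} = set (canonical_pattern r))"
    unfolding image by (rule bilinear_patterns[OF *(1) *(2)[unfolded image] *(3,4)])
  then show "k = 3" "\<exists>r>0. {X, Y} \<union> {?F i | i. i \<in> {1..k}} =
      {X, Y, Const r * X * Y, Const r * X * Y + X, Const r * X * Y + Y}"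
    by (auto simp: canonical_pattern_def)
next
  fix r :: rat assume "r > 0"
  then show "polynomial_pattern_regular
        [X, Y, Const r * X * Y, Const r * X * Y + X, Const r * X * Y + Y] \<longleftrightarrow>
      polynomial_pattern_regular [X, Y, X * Y, X * Y + X, X * Y + Y]"
    using canonical_pattern_rescale[of r 1] canonical_pattern_rescale[of 1 r]
    unfolding canonical_pattern_1 by (auto simp: canonical_pattern_def)
qed

end
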